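(* Fix current beamformers $\{\underline{\mathbf{W}}_i\}$ and perform one round of the WSR-FP algorithm for MIMO beamforming: for $k=1,\dots,K$, $$\boldsymbol{\Phi}_k=(\underline{\mathbf{F}}_k+\mathbf{H}_{k,k}\underline{\mathbf{W}}_k\underline{\mathbf{W}}_k^{\mathsf{H}}\mathbf{H}_{k,k}^{\mathsf{H}})^{-1}\sqrt{\omega_k}\,\mathbf{H}_{k,k}\underline{\mathbf{W}}_k,\qquad \boldsymbol{\Gamma}_k=\underline{\mathbf{W}}_k^{\mathsf{H}}\mathbf{H}_{k,k}^{\mathsf{H}}\underline{\mathbf{F}}_k^{-1}\mathbf{H}_{k,k}\underline{\mathbf{W}}_k,$$ $$\mathbf{W}_k=\Bigl(\sum_{j=1}^{K}\mathbf{H}_{j,k}^{\mathsf{H}}\boldsymbol{\Phi}_j(\mathbf{I}+\boldsymbol{\Gamma}_j)\boldsymbol{\Phi}_j^{\mathsf{H}}\mathbf{H}_{j,k}+\mu_k\mathbf{I}\Bigr)^{\dagger}\sqrt{\omega_k}\,\mathbf{H}_{k,k}^{\mathsf{H}}\boldsymbol{\Phi}_k(\mathbf{I}+\boldsymbol{\Gamma}_k).$$ Then $\frac{1}{\omega_k}\boldsymbol{\Phi}_k(\mathbf{I}+\boldsymbol{\Gamma}_k)\boldsymbol{\Phi}_k^{\mathsf{H}}=\mathbf{A}_k$ and $\frac{1}{\sqrt{\omega_k}}(\mathbf{I}+\boldsymbol{\Gamma}_k^{\mathsf{H}})\boldsymbol{\Phi}_k^{\mathsf{H}}=\mathbf{B}_k$,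 where $\mathbf{B}_k=\underline{\mathbf{W}}_k^{\mathsf{H}}\mathbf{H}_{k,k}^{\mathsf{H}}\underline{\mathbf{F}}_k^{-1}$ and $\mathbf{A}_k=(\underline{\mathbf{F}}_k+\mathbf{H}_{k,k}\underline{\mathbf{W}}_k\underline{\mathbf{W}}_k^{\mathsf{H}}\mathbf{H}_{k,k}^{\mathsf{H}})^{-1}\mathbf{H}_{k,k}\underline{\mathbf{W}}_k\mathbf{B}_k$. Consequently the resulting beamformers $\{\mathbf{W}_k\}$ coincide with those produced from $\{\underline{\mathbf{W}}_i\}$ by the WSR-MM algorithm, $$\mathbf{W}_k=\Bigl(\sum_{j=1}^{K}\omega_j\mathbf{H}_{j,k}^{\mathsf{H}}\mathbf{A}_j\mathbf{H}_{j,k}+\mu_k\mathbf{I}\Bigr)^{\dagger}\omega_k\mathbf{H}_{k,k}^{\mathsf{H}}\mathbf{B}_k^{\mathsf{H}}.$$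
   Context: Setting: $K$ links; $\mathbf{H}_{i,j}\in\mathbb{C}^{M_i^{\mathsf r}\times M_j^{\mathsf t}}$ is the channel from transmitter $j$ to receiver $i$; $\mathbf{W}_k\in\mathbb{C}^{M_k^{\mathsf t}\times M_k^{\mathsf s}}$ is the beamformer of link $k$; $\sigma_k^2>0$ noise variances, $\omega_k>0$ weights, $P_k>0$ power budgets. $\underline{\mathbf{F}}_k=\sum_{j\ne k}\mathbf{H}_{k,j}\underline{\mathbf{W}}_j\underline{\mathbf{W}}_j^{\mathsf{H}}\mathbf{H}_{k,j}^{\mathsf{H}}+\sigma_k^2\mathbf{I}$. $(\cdot)^\dagger$ is the Moore–Penrose pseudo-inverse and $\|\cdot\|$ the Frobenius norm. In both algorithms, viewing the displayed formula for $\mathbf{W}_k$ as a function $\mathbf{W}_k(\mu_k)$ of $\mu_k$, the multiplier is chosen as $\mu_k=\min\{\mu_k\ge 0:\|\mathbf{W}_k(\mu_k)\|^2\le P_k\}$. *)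

theory Defs
  imports Jordan_Normal_Form.Schur_Decomposition Jordan_Normal_Form.Gauss_Jordan_Elimination
    Complex_Main
begin

text \<open>The dimensions vary from link to link, so matrices are carrier-based.\<close>

abbreviation adjoint :: "complex mat \<Rightarrow> complex mat"  (\<open>_\<^sup>H\<close> [1000] 999)
  where "M\<^sup>H \<equiv> mat_adjoint M"

abbreviation real_smult :: "real \<Rightarrow> complex mat \<Rightarrow> complex mat"  (infixr \<open>\<cdot>\<^sub>r\<close> 75)
  where "c \<cdot>\<^sub>r M \<equiv> complex_of_real c \<cdot>\<^sub>m M"

definition mat_sum :: "nat \<Rightarrow> nat \<Rightarrow> (nat \<Rightarrow> complex mat) \<Rightarrow> nat set \<Rightarrow> complex mat"
  where "mat_sum nr nc f S = finsum (module_mat TYPE(complex) nr nc) f S"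

text \<open>Unspecified unless the argument is a square invertible matrix.\<close>
definition minv :: "complex mat \<Rightarrow> complex mat"
  where "minv M = the (mat_inverse M)"

definition is_pseudo_inverse :: "complex mat \<Rightarrow> complex mat \<Rightarrow> bool"
  where "is_pseudo_inverse M X \<longleftrightarrow>
    X \<in> carrier_mat (dim_col M) (dim_row M) \<and>
    M * X * M = M \<and> X * M * X = X \<and>
    (M * X)\<^sup>H = M * X \<and> (X * M)\<^sup>H = X * M"

definition pinv :: "complex mat \<Rightarrow> complex mat"
  where "pinv M = (THE X. is_pseudo_inverse M X)"

definition frob_norm :: "complex mat \<Rightarrow> real"
  where "frob_norm M = sqrt (\<Sum>i<dim_row M. \<Sum>j<dim_col M. (cmod (M $$ (i, j)))\<^sup>2)"

text \<open>
  Links are numbered from 1 to \<open>links N\<close>.  The matrix \<open>chan N i j\<close> is the channel from transmitter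
  \<open>j\<close> to receiver \<open>i\<close>, and \<open>noise_var N k\<close> is the variance itself (the square of sigma).
\<close>
record mimo_network =
  links :: nat
  rx_dim :: "nat \<Rightarrow> nat"
  tx_dim :: "nat \<Rightarrow> nat"
  stream_dim :: "nat \<Rightarrow> nat"
  chan :: "nat \<Rightarrow> nat \<Rightarrow> complex mat"
  noise_var :: "nat \<Rightarrow> real"
  weight :: "nat \<Rightarrow> real"
  budget :: "nat \<Rightarrow> real"

definition valid_network :: "mimo_network \<Rightarrow> bool"
  where "valid_network N \<longleftrightarrow>
    (\<forall>i\<in>{1..links N}. \<forall>j\<in>{1..links N}. chan N i j \<in> carrier_mat (rx_dim N i) (tx_dim N j)) \<and>
    (\<forall>k\<in>{1..links N}. noise_var N k > 0 \<and> weight N k > 0 \<and> budget N k > 0)"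

definition beamformers :: "mimo_network \<Rightarrow> (nat \<Rightarrow> complex mat) \<Rightarrow> bool"
  where "beamformers N W \<longleftrightarrow>
    (\<forall>k\<in>{1..links N}. W k \<in> carrier_mat (tx_dim N k) (stream_dim N k))"

definition interference :: "mimo_network \<Rightarrow> (nat \<Rightarrow> complex mat) \<Rightarrow> nat \<Rightarrow> complex mat"
  where "interference N W k =
    mat_sum (rx_dim N k) (rx_dim N k)
      (\<lambda>j. chan N k j * W j * (W j)\<^sup>H * (chan N k j)\<^sup>H) ({1..links N} - {k})
    + noise_var N k \<cdot>\<^sub>r 1\<^sub>m (rx_dim N k)"

definition total_cov :: "mimo_network \<Rightarrow> (nat \<Rightarrow> complex mat) \<Rightarrow> nat \<Rightarrow> complex mat"
  where "total_cov N W k =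
    interference N W k + chan N k k * W k * (W k)\<^sup>H * (chan N k k)\<^sup>H"

text \<open>The minimal feasible multiplier for a beamformer that depends on the multiplier.\<close>
definition min_multiplier :: "real \<Rightarrow> (real \<Rightarrow> complex mat) \<Rightarrow> real"
  where "min_multiplier p V = (LEAST \<mu>. 0 \<le> \<mu> \<and> (frob_norm (V \<mu>))\<^sup>2 \<le> p)"


subsection \<open>WSR-FP\<close>

definition fp_Phi :: "mimo_network \<Rightarrow> (nat \<Rightarrow> complex mat) \<Rightarrow> nat \<Rightarrow> complex mat"
  where "fp_Phi N W k =
    minv (total_cov N W k) * (sqrt (weight N k) \<cdot>\<^sub>r (chan N k k * W k))"

definition fp_Gamma :: "mimo_network \<Rightarrow> (nat \<Rightarrow> complex mat) \<Rightarrow> nat \<Rightarrow> complex mat"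
  where "fp_Gamma N W k =
    (W k)\<^sup>H * (chan N k k)\<^sup>H * minv (interference N W k) * chan N k k * W k"

definition fp_update :: "mimo_network \<Rightarrow> (nat \<Rightarrow> complex mat) \<Rightarrow> nat \<Rightarrow> real \<Rightarrow> complex mat"
  where "fp_update N W k \<mu> =
    pinv (mat_sum (tx_dim N k) (tx_dim N k)
        (\<lambda>j. (chan N j k)\<^sup>H * fp_Phi N W j * (1\<^sub>m (stream_dim N j) + fp_Gamma N W j)
              * (fp_Phi N W j)\<^sup>H * chan N j k) {1..links N}
      + \<mu> \<cdot>\<^sub>r 1\<^sub>m (tx_dim N k))
    * (sqrt (weight N k) \<cdot>\<^sub>r
        ((chan N k k)\<^sup>H * fp_Phi N W k * (1\<^sub>m (stream_dim N k) + fp_Gamma N W k)))"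

definition fp_beamformer :: "mimo_network \<Rightarrow> (nat \<Rightarrow> complex mat) \<Rightarrow> nat \<Rightarrow> complex mat"
  where "fp_beamformer N W k =
    fp_update N W k (min_multiplier (budget N k) (fp_update N W k))"


subsection \<open>WSR-MM\<close>

definition mm_B :: "mimo_network \<Rightarrow> (nat \<Rightarrow> complex mat) \<Rightarrow> nat \<Rightarrow> complex mat"
  where "mm_B N W k = (W k)\<^sup>H * (chan N k k)\<^sup>H * minv (interference N W k)"

definition mm_A :: "mimo_network \<Rightarrow> (nat \<Rightarrow> complex mat) \<Rightarrow> nat \<Rightarrow> complex mat"
  where "mm_A N W k = minv (total_cov N W k) * chan N k k * W k * mm_B N W k"

definition mm_update :: "mimo_network \<Rightarrow> (nat \<Rightarrow> complex mat) \<Rightarrow> nat \<Rightarrow> real \<Rightarrow> complex mat"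
  where "mm_update N W k \<mu> =
    pinv (mat_sum (tx_dim N k) (tx_dim N k)
        (\<lambda>j. weight N j \<cdot>\<^sub>r ((chan N j k)\<^sup>H * mm_A N W j * chan N j k)) {1..links N}
      + \<mu> \<cdot>\<^sub>r 1\<^sub>m (tx_dim N k))
    * (weight N k \<cdot>\<^sub>r ((chan N k k)\<^sup>H * (mm_B N W k)\<^sup>H))"

definition mm_beamformer :: "mimo_network \<Rightarrow> (nat \<Rightarrow> complex mat) \<Rightarrow> nat \<Rightarrow> complex mat"
  where "mm_beamformer N W k =
    mm_update N W k (min_multiplier (budget N k) (mm_update N W k))"

end

(*
  Put G = H_kk W_k, F the interference covariance and T = F + G G^H, so that Gamma = G^H F^-1 G and
  T F^-1 G = G (I + Gamma).  Hence T^-1 G (I + Gamma) = F^-1 G, that is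
  Phi (I + Gamma) = sqrt omega F^-1 G = sqrt omega B^H, and everything else is this identity, its
  adjoint, and Gamma^H = Gamma.  The inverses exist because F and T are hermitian and dominate
  sigma^2 I with sigma^2 > 0.
*)
theory Submission
  imports Defs
begin

section \<open>Adjoints\<close>

lemma adjoint_dim [simp]: "dim_row (A\<^sup>H) = dim_col A" "dim_col (A\<^sup>H) = dim_row A"
  by (simp_all add: mat_adjoint_def)

lemma adjoint_carrier [simp]: "A \<in> carrier_mat m n \<Longrightarrow> A\<^sup>H \<in> carrier_mat n m"
  by (auto intro!: carrier_matI)

text \<open>\<open>mat_adjoint\<close> is built by taking the conjugated columns as rows. This entry
  formula is what the \<open>eq_matI\<close> proofs below compute with.\<close>

lemma adjoint_index [simp]:
  "i < dim_col A \<Longrightarrow> j < dim_row A \<Longrightarrow> A\<^sup>H $$ (i, j) = cnj (A $$ (j, i))"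
  by (simp add: mat_adjoint_def mat_of_rows_def)

lemma adjoint_adjoint [simp]: "(A\<^sup>H)\<^sup>H = A"
  by (rule eq_matI) auto

lemma adjoint_zero [simp]: "(0\<^sub>m m n)\<^sup>H = 0\<^sub>m n m"
  by (rule eq_matI) auto

lemma adjoint_one [simp]: "(1\<^sub>m n)\<^sup>H = 1\<^sub>m n"
  by (rule eq_matI) auto

lemma adjoint_real_smult: "(c \<cdot>\<^sub>r A)\<^sup>H = c \<cdot>\<^sub>r A\<^sup>H"
  by (rule eq_matI) auto

lemma adjoint_add:
  assumes "A \<in> carrier_mat m n" "B \<in> carrier_mat m n"
  shows "(A + B)\<^sup>H = A\<^sup>H + B\<^sup>H"
  using assms by (intro eq_matI) auto

lemma adjoint_mult:
  assumes "A \<in> carrier_mat m n" "B \<in> carrier_mat n p"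
  shows "(A * B)\<^sup>H = B\<^sup>H * A\<^sup>H"
  using assms by (intro eq_matI) (auto simp: scalar_prod_def mult.commute)

text \<open>Since \<open>\<bullet>c\<close> conjugates its second argument, both sides expand to the
  same double sum, taken in the two orders of summation.\<close>

lemma adjoint_cscalar_prod:
  assumes A: "A \<in> carrier_mat m n" and v: "v \<in> carrier_vec n" and w: "w \<in> carrier_vec m"
  shows "(A *\<^sub>v v) \<bullet>c w = v \<bullet>c (A\<^sup>H *\<^sub>v w)"
proof -
  have "(A *\<^sub>v v) \<bullet>c w = (\<Sum>i<m. \<Sum>j<n. A $$ (i, j) * v $ j * cnj (w $ i))"
    using A v w by (simp add: scalar_prod_def sum_distrib_right atLeast0LessThan)
  also have "\<dots> = (\<Sum>j<n. \<Sum>i<m. A $$ (i, j) * v $ j * cnj (w $ i))"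
    by (rule sum.swap)
  also have "\<dots> = v \<bullet>c (A\<^sup>H *\<^sub>v w)"
    using A v w by (simp add: scalar_prod_def sum_distrib_left atLeast0LessThan mult_ac)
  finally show ?thesis .
qed


section \<open>Positive semidefinite matrices\<close>

text \<open>In the order on \<open>complex\<close>, \<open>0 \<le> z\<close> says that z is real and
  nonnegative, so the quadratic form can be compared with 0 without taking
  \<open>Re\<close>.\<close>

definition psd_mat :: "nat \<Rightarrow> complex mat \<Rightarrow> bool"
  where "psd_mat n A \<longleftrightarrow> A \<in> carrier_mat n n \<and> A\<^sup>H = A \<and>
    (\<forall>v\<in>carrier_vec n. 0 \<le> (A *\<^sub>v v) \<bullet>c v)"

lemma psd_mat_carrier: "psd_mat n A \<Longrightarrow> A \<in> carrier_mat n n"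
  by (simp add: psd_mat_def)

lemma psd_mat_zero: "psd_mat n (0\<^sub>m n n)"
proof -
  have "0\<^sub>m n n *\<^sub>v v = 0\<^sub>v n" if "v \<in> carrier_vec n" for v :: "complex vec"
    using that by (intro eq_vecI) auto
  then show ?thesis
    by (simp add: psd_mat_def)
qed

lemma psd_mat_add:
  assumes "psd_mat n A" "psd_mat n B"
  shows "psd_mat n (A + B)"
  using assms
  by (auto simp: psd_mat_def adjoint_add add_mult_distrib_mat_vec[of _ n n]
      add_scalar_prod_distrib[of _ n])

text \<open>The quadratic form of \<open>X * X\<^sup>H\<close> at v is the squared norm of
  \<open>X\<^sup>H *\<^sub>v v\<close>.\<close>

lemma psd_mat_mult_adjoint:
  assumes X: "X \<in> carrier_mat n p"
  shows "psd_mat n (X * X\<^sup>H)"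
proof -
  have "0 \<le> (X * X\<^sup>H *\<^sub>v v) \<bullet>c v" if v: "v \<in> carrier_vec n" for v
  proof -
    have "(X * X\<^sup>H *\<^sub>v v) \<bullet>c v = (X\<^sup>H *\<^sub>v v) \<bullet>c (X\<^sup>H *\<^sub>v v)"
      using X v by (subst assoc_mult_mat_vec[of _ n p _ n])
        (auto intro!: adjoint_cscalar_prod mult_mat_vec_carrier[of _ p n])
    then show ?thesis
      by (simp add: conjugate_square_ge_0_vec)
  qed
  with X show ?thesis
    by (auto simp: psd_mat_def adjoint_mult[of X n p "X\<^sup>H" n])
qed

section \<open>Finite sums of matrices\<close>

lemma mat_sum_empty [simp]: "mat_sum m n f {} = 0\<^sub>m m n"
proof -
  interpret abelian_group "module_mat TYPE(complex) m n"
    by (rule abelian_group_mat)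
  show ?thesis
    by (simp add: mat_sum_def module_mat_simps)
qed

text \<open>\<open>mat_sum\<close> is a \<open>finsum\<close> in the additive group of m by n
  matrices. The recursion is that of an abelian group, for summands in its carrier.\<close>

lemma mat_sum_insert:
  assumes "finite S" "a \<notin> S" "\<And>j. j \<in> insert a S \<Longrightarrow> f j \<in> carrier_mat m n"
  shows "mat_sum m n f (insert a S) = f a + mat_sum m n f S"
proof -
  interpret abelian_group "module_mat TYPE(complex) m n"
    by (rule abelian_group_mat)
  show ?thesis
    using assms finsum_insert[of S a f] by (auto simp: mat_sum_def module_mat_simps Pi_def)
qed

lemma mat_sum_cong:
  assumes "\<And>j. j \<in> S \<Longrightarrow> f j = g j" "\<And>j. j \<in> S \<Longrightarrow> g j \<in> carrier_mat m n"
  shows "mat_sum m n f S = mat_sum m n g S"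
proof -
  interpret abelian_group "module_mat TYPE(complex) m n"
    by (rule abelian_group_mat)
  show ?thesis
    unfolding mat_sum_def using assms by (intro finsum_cong') (auto simp: module_mat_simps)
qed

lemma psd_mat_sum:
  assumes "finite S" "\<And>j. j \<in> S \<Longrightarrow> psd_mat n (f j)"
  shows "psd_mat n (mat_sum n n f S)"
  using assms
proof (induction S rule: finite_induct)
  case (insert a S)
  then have "mat_sum n n f (insert a S) = f a + mat_sum n n f S"
    by (intro mat_sum_insert psd_mat_carrier) auto
  with insert show ?case
    by (simp add: psd_mat_add)
qed (simp add: psd_mat_zero)

text \<open>Positive definiteness in the form in which covariances provide it: a semidefinite part
  plus a positive multiple of the identity, the load c.\<close>

definition loaded_mat :: "nat \<Rightarrow> complex mat \<Rightarrow> bool"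
  where "loaded_mat n F \<longleftrightarrow> (\<exists>P c. psd_mat n P \<and> 0 < c \<and> F = P + c \<cdot>\<^sub>r 1\<^sub>m n)"

lemma loaded_matI: "psd_mat n P \<Longrightarrow> 0 < c \<Longrightarrow> loaded_mat n (P + c \<cdot>\<^sub>r 1\<^sub>m n)"
  by (auto simp: loaded_mat_def)

lemma loaded_mat_add_psd:
  assumes "loaded_mat n F" and Q: "psd_mat n Q"
  shows "loaded_mat n (F + Q)"
proof -
  from assms(1) obtain P c where P: "psd_mat n P" "0 < c" "F = P + c \<cdot>\<^sub>r 1\<^sub>m n"
    unfolding loaded_mat_def by blast
  \<comment> \<open>Q is absorbed into the semidefinite part, so the load c stays the same.\<close>
  have "F + Q = (P + Q) + c \<cdot>\<^sub>r 1\<^sub>m n"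
    using P psd_mat_carrier[OF P(1)] psd_mat_carrier[OF Q] by (intro eq_matI) auto
  then show ?thesis
    using loaded_matI[OF psd_mat_add[OF P(1) Q] P(2)] by simp
qed

lemma loaded_mat_carrier: "loaded_mat n F \<Longrightarrow> F \<in> carrier_mat n n"
  by (auto simp: loaded_mat_def psd_mat_def)

lemma loaded_mat_adjoint:
  assumes "loaded_mat n F"
  shows "F\<^sup>H = F"
  using assms
  by (auto simp: loaded_mat_def psd_mat_def adjoint_real_smult adjoint_add[of _ n n])

text \<open>If \<open>F *\<^sub>v v = 0\<close> with v nonzero, the quadratic form of F at v is 0.
  But it is the sum of a nonnegative term from P and c times the squared norm of v, which is
  positive.\<close>

lemma loaded_mat_det:
  assumes "loaded_mat n F"
  shows "det F \<noteq> 0"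
proof
  assume "det F = 0"
  then obtain v where v: "v \<in> carrier_vec n" "v \<noteq> 0\<^sub>v n" and Fv: "F *\<^sub>v v = 0\<^sub>v n"
    using det_0_iff_vec_prod_zero_field[OF loaded_mat_carrier[OF assms]] by blast
  from assms obtain P c where P: "psd_mat n P" and c: "0 < c" and F: "F = P + c \<cdot>\<^sub>r 1\<^sub>m n"
    unfolding loaded_mat_def by blast
  have Pc: "P \<in> carrier_mat n n" by (rule psd_mat_carrier[OF P])
  have "(c \<cdot>\<^sub>r 1\<^sub>m n) *\<^sub>v v = complex_of_real c \<cdot>\<^sub>v v"
    using v(1) by (intro eq_vecI) auto
  then have "F *\<^sub>v v = P *\<^sub>v v + complex_of_real c \<cdot>\<^sub>v v"
    unfolding F using Pc v(1) by (subst add_mult_distrib_mat_vec[of _ n n]) auto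
  then have "0 = (P *\<^sub>v v + complex_of_real c \<cdot>\<^sub>v v) \<bullet>c v"
    using Fv v(1) by (metis carrier_vec_conjugate scalar_prod_left_zero)
  also have "\<dots> = (P *\<^sub>v v) \<bullet>c v + complex_of_real c * (v \<bullet>c v)"
    using Pc v(1) by (subst add_scalar_prod_distrib[of _ n]) auto
  finally have sum0: "(P *\<^sub>v v) \<bullet>c v + complex_of_real c * (v \<bullet>c v) = 0" by simp
  have "0 \<le> (P *\<^sub>v v) \<bullet>c v"
    using P v(1) by (simp add: psd_mat_def)
  moreover have "0 < v \<bullet>c v"
    using v by simp
  \<comment> \<open>The contradiction is drawn between real parts, where the order is
    linear.\<close>
  ultimately have "0 \<le> Re ((P *\<^sub>v v) \<bullet>c v)" "0 < c * Re (v \<bullet>c v)"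
    using c by (auto simp: less_eq_complex_def less_complex_def)
  moreover have "Re ((P *\<^sub>v v) \<bullet>c v) + c * Re (v \<bullet>c v) = 0"
    using arg_cong[OF sum0, of Re] by simp
  ultimately show False by linarith
qed

text \<open>A nonzero determinant makes A a unit of the matrix ring, so \<open>mat_inverse\<close>
  returns \<open>Some\<close> and \<open>the\<close> in \<open>minv\<close> picks a genuine
  two-sided inverse.\<close>

lemma minv_inverts:
  assumes A: "A \<in> carrier_mat n n" and "det A \<noteq> 0"
  shows "minv A \<in> carrier_mat n n" "minv A * A = 1\<^sub>m n" "A * minv A = 1\<^sub>m n"
proof -
  have "A \<in> Units (ring_mat TYPE(complex) n ())"
    using det_non_zero_imp_unit[OF assms] .
  then obtain B where "mat_inverse A = Some B"
    using mat_inverse(1)[OF A, where b = "()"] by (cases "mat_inverse A") auto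
  then show "minv A \<in> carrier_mat n n" "minv A * A = 1\<^sub>m n" "A * minv A = 1\<^sub>m n"
    using mat_inverse(2)[OF A] by (auto simp: minv_def)
qed

text \<open>The adjoint of \<open>A * minv A = 1\<^sub>m n\<close> shows that
  \<open>(minv A)\<^sup>H\<close> is a left inverse of A, and a left inverse equals a right
  inverse.\<close>

lemma minv_adjoint:
  assumes A: "A \<in> carrier_mat n n" and d: "det A \<noteq> 0" and h: "A\<^sup>H = A"
  shows "(minv A)\<^sup>H = minv A"
proof -
  note i = minv_inverts[OF A d]
  have "(minv A)\<^sup>H * A = 1\<^sub>m n"
    using arg_cong[OF i(3), of mat_adjoint] by (simp add: adjoint_mult[OF A i(1)] h)
  then have "(minv A)\<^sup>H * (A * minv A) = minv A"
    using A i(1) by (subst assoc_mult_mat[symmetric, of _ n n _ n _ n]) auto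
  then show ?thesis
    using i by simp
qed


section \<open>Comparing the two updates\<close>

lemma smult_smult_times: "a \<cdot>\<^sub>m (b \<cdot>\<^sub>m A) = (a * b) \<cdot>\<^sub>m (A :: 'a :: semigroup_mult mat)"
  by (rule eq_matI) (auto simp: mult.assoc)

lemma one_smult: "1 \<cdot>\<^sub>m A = (A :: 'a :: monoid_mult mat)"
  by (rule eq_matI) auto

text \<open>Turns the left-associated products of the covariance definitions into the shape
  \<open>X * X\<^sup>H\<close> to which \<open>psd_mat_mult_adjoint\<close> applies.\<close>

lemma gram_assoc:
  assumes "H \<in> carrier_mat m n" "V \<in> carrier_mat n p"
  shows "H * V * V\<^sup>H * H\<^sup>H = (H * V) * (H * V)\<^sup>H"
  using assms
  by (simp add: adjoint_mult[OF assms] assoc_mult_mat[of "H * V" m p "V\<^sup>H" n "H\<^sup>H" m])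

text \<open>Both terms of \<open>(F + G * G\<^sup>H) * (minv F * G)\<close> have G as left factor.
  Pulling it out and cancelling the outer matrix trades the inverse of the sum for the inverse of
  F.\<close>

lemma push_through:
  assumes F: "F \<in> carrier_mat n n" "det F \<noteq> 0"
    and T: "det (F + G * G\<^sup>H) \<noteq> 0"
    and G: "G \<in> carrier_mat n p"
  shows "minv (F + G * G\<^sup>H) * G * (1\<^sub>m p + G\<^sup>H * minv F * G) = minv F * G"
proof -
  let ?T = "F + G * G\<^sup>H" and ?\<Gamma> = "G\<^sup>H * minv F * G"
  note Fi = minv_inverts[OF F]
  have Tc: "?T \<in> carrier_mat n n" using F G by auto
  note Ti = minv_inverts[OF Tc T]
  have X: "minv F * G \<in> carrier_mat n p" using Fi G by auto
  have "?T * (minv F * G) = F * (minv F * G) + G * G\<^sup>H * (minv F * G)"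
    using F G X by (intro add_mult_distrib_mat) auto
  also have "F * (minv F * G) = G"
    using F Fi G by (subst assoc_mult_mat[symmetric, of _ n n _ n _ p]) auto
  also have "G * G\<^sup>H * (minv F * G) = G * (G\<^sup>H * (minv F * G))"
    using G X by (intro assoc_mult_mat[of _ n p _ n _ p]) auto
  also have "G\<^sup>H * (minv F * G) = ?\<Gamma>"
    using G Fi by (intro assoc_mult_mat[symmetric, of _ p n _ n _ p]) auto
  also have "G + G * ?\<Gamma> = G * (1\<^sub>m p + ?\<Gamma>)"
    using G Fi by (subst mult_add_distrib_mat[of _ n p _ p]) auto
  finally have eq: "G * (1\<^sub>m p + ?\<Gamma>) = ?T * (minv F * G)" by simp
  have "minv ?T * G * (1\<^sub>m p + ?\<Gamma>) = minv ?T * (G * (1\<^sub>m p + ?\<Gamma>))"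
    using Ti G Fi by (intro assoc_mult_mat[of _ n n _ p _ p]) auto
  also have "\<dots> = minv ?T * ?T * (minv F * G)"
    unfolding eq using Ti Tc X by (intro assoc_mult_mat[symmetric, of _ n n _ n _ p]) auto
  also have "\<dots> = minv F * G"
    using Ti left_mult_one_mat[OF X] by simp
  finally show ?thesis .
qed

section \<open>Identities for a single link\<close>

context
  fixes N :: mimo_network and W :: "nat \<Rightarrow> complex mat" and k :: nat
  assumes valid: "valid_network N" and bf: "beamformers N W" and k: "k \<in> {1..links N}"
begin

lemma dims:
  "i \<in> {1..links N} \<Longrightarrow> j \<in> {1..links N} \<Longrightarrow> chan N i j \<in> carrier_mat (rx_dim N i) (tx_dim N j)"
  "j \<in> {1..links N} \<Longrightarrow> W j \<in> carrier_mat (tx_dim N j) (stream_dim N j)"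
  using valid bf by (auto simp: valid_network_def beamformers_def)

lemma weight_pos: "0 < weight N k"
  using valid k by (auto simp: valid_network_def)

lemma signal_carrier: "chan N k k * W k \<in> carrier_mat (rx_dim N k) (stream_dim N k)"
  using dims[OF k] dims(1)[OF k k] by auto

text \<open>Each interferer contributes a Gram matrix, and the positive noise variance is the
  load.\<close>

lemma loaded_interference: "loaded_mat (rx_dim N k) (interference N W k)"
  unfolding interference_def
proof (intro loaded_matI psd_mat_sum)
  fix j assume "j \<in> {1..links N} - {k}"
  then have c: "chan N k j \<in> carrier_mat (rx_dim N k) (tx_dim N j)"
    "W j \<in> carrier_mat (tx_dim N j) (stream_dim N j)"
    using dims k by auto
  show "psd_mat (rx_dim N k) (chan N k j * W j * (W j)\<^sup>H * (chan N k j)\<^sup>H)"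
    unfolding gram_assoc[OF c] by (rule psd_mat_mult_adjoint[OF mult_carrier_mat[OF c]])
qed (use valid k in \<open>auto simp: valid_network_def\<close>)

text \<open>The shape \<open>F + G * G\<^sup>H\<close> of \<open>push_through\<close>, with
  \<open>chan N k k * W k\<close> as G.\<close>

lemma total_cov_eq:
  "total_cov N W k = interference N W k + (chan N k k * W k) * (chan N k k * W k)\<^sup>H"
  unfolding total_cov_def gram_assoc[OF dims(1)[OF k k] dims(2)[OF k]] ..

lemma loaded_total_cov: "loaded_mat (rx_dim N k) (total_cov N W k)"
  unfolding total_cov_eq
  by (rule loaded_mat_add_psd[OF loaded_interference psd_mat_mult_adjoint[OF signal_carrier]])

lemmas interference_inverse =
  minv_inverts[OF loaded_mat_carrier[OF loaded_interference] loaded_mat_det[OF loaded_interference]]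
  minv_adjoint[OF loaded_mat_carrier[OF loaded_interference] loaded_mat_det[OF loaded_interference]
    loaded_mat_adjoint[OF loaded_interference]]

lemmas total_cov_inverse =
  minv_inverts[OF loaded_mat_carrier[OF loaded_total_cov] loaded_mat_det[OF loaded_total_cov]]

lemma mm_B_eq: "mm_B N W k = (chan N k k * W k)\<^sup>H * minv (interference N W k)"
  by (simp add: mm_B_def adjoint_mult[OF dims(1)[OF k k] dims(2)[OF k]])

lemma mm_B_carrier: "mm_B N W k \<in> carrier_mat (stream_dim N k) (rx_dim N k)"
  unfolding mm_B_eq by (rule mult_carrier_mat[OF adjoint_carrier[OF signal_carrier] interference_inverse(1)])

text \<open>Both sides start with \<open>mm_B N W k\<close>, once as defined and once as in
  \<open>mm_B_eq\<close>, which leaves a single regrouping of the last two factors.\<close>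

lemma fp_Gamma_eq:
  "fp_Gamma N W k =
    (chan N k k * W k)\<^sup>H * minv (interference N W k) * (chan N k k * W k)"
  using assoc_mult_mat[OF mm_B_carrier dims(1)[OF k k] dims(2)[OF k]]
  unfolding fp_Gamma_def mm_B_eq[symmetric] mm_B_def[symmetric] .

text \<open>The interference covariance is hermitian, so its inverse passes unchanged through the
  adjoint. The result is the right-hand side of \<open>push_through\<close>.\<close>

lemma mm_B_adjoint: "(mm_B N W k)\<^sup>H = minv (interference N W k) * (chan N k k * W k)"
  unfolding mm_B_eq using signal_carrier interference_inverse
  by (subst adjoint_mult[of _ "stream_dim N k" "rx_dim N k" _ "rx_dim N k"]) auto

lemma fp_Gamma_carrier: "fp_Gamma N W k \<in> carrier_mat (stream_dim N k) (stream_dim N k)"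
  unfolding fp_Gamma_eq mm_B_eq[symmetric]
  by (rule mult_carrier_mat[OF mm_B_carrier signal_carrier])

text \<open>With Gamma = B G, the adjoint is G^H B^H = G^H (F^-1 G), which is Gamma again in another
  bracketing.\<close>

lemma fp_Gamma_adjoint: "(fp_Gamma N W k)\<^sup>H = fp_Gamma N W k"
proof -
  have "(fp_Gamma N W k)\<^sup>H = (chan N k k * W k)\<^sup>H * (mm_B N W k)\<^sup>H"
    unfolding fp_Gamma_eq mm_B_eq[symmetric]
    by (rule adjoint_mult[OF mm_B_carrier signal_carrier])
  also have "\<dots> = fp_Gamma N W k"
    unfolding mm_B_adjoint fp_Gamma_eq
    by (rule assoc_mult_mat[OF adjoint_carrier[OF signal_carrier] interference_inverse(1)
          signal_carrier, symmetric])
  finally show ?thesis .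
qed

lemma fp_Phi_carrier: "fp_Phi N W k \<in> carrier_mat (rx_dim N k) (stream_dim N k)"
  unfolding fp_Phi_def
  by (rule mult_carrier_mat[OF total_cov_inverse(1) smult_carrier_mat[OF signal_carrier]])

lemma fp_Phi_eq:
  "fp_Phi N W k = sqrt (weight N k) \<cdot>\<^sub>r (minv (total_cov N W k) * (chan N k k * W k))"
  unfolding fp_Phi_def by (rule mult_smult_distrib[OF total_cov_inverse(1) signal_carrier])

lemma mm_A_eq:
  "mm_A N W k = minv (total_cov N W k) * (chan N k k * W k) * mm_B N W k"
  unfolding mm_A_def
  by (simp add: assoc_mult_mat[OF total_cov_inverse(1) dims(1)[OF k k] dims(2)[OF k]])

lemma mm_A_carrier: "mm_A N W k \<in> carrier_mat (rx_dim N k) (rx_dim N k)"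
  unfolding mm_A_eq
  by (rule mult_carrier_mat[OF mult_carrier_mat[OF total_cov_inverse(1) signal_carrier] mm_B_carrier])

text \<open>An instance of \<open>push_through\<close>, scaled by the factor
  \<open>sqrt (weight N k)\<close> contained in \<open>fp_Phi\<close>.\<close>

lemma Phi_Gamma:
  "fp_Phi N W k * (1\<^sub>m (stream_dim N k) + fp_Gamma N W k)
    = sqrt (weight N k) \<cdot>\<^sub>r (mm_B N W k)\<^sup>H"
proof -
  have "minv (total_cov N W k) * (chan N k k * W k)
      * (1\<^sub>m (stream_dim N k) + fp_Gamma N W k) = (mm_B N W k)\<^sup>H"
    unfolding mm_B_adjoint fp_Gamma_eq total_cov_eq
    by (rule push_through[OF loaded_mat_carrier[OF loaded_interference]
          loaded_mat_det[OF loaded_interference]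
          loaded_mat_det[OF loaded_total_cov[unfolded total_cov_eq]] signal_carrier])
  then show ?thesis
    unfolding fp_Phi_eq using total_cov_inverse(1) signal_carrier fp_Gamma_carrier
    by (subst mult_smult_assoc_mat[of _ "rx_dim N k" "stream_dim N k" _ "stream_dim N k"]) auto
qed

text \<open>The adjoint of \<open>Phi_Gamma\<close>; the scalar is real and hence unaffected by
  conjugation.\<close>

lemma Gamma_Phi_adjoint:
  "(1\<^sub>m (stream_dim N k) + (fp_Gamma N W k)\<^sup>H) * (fp_Phi N W k)\<^sup>H
    = sqrt (weight N k) \<cdot>\<^sub>r mm_B N W k"
proof -
  have c: "1\<^sub>m (stream_dim N k) + fp_Gamma N W k \<in> carrier_mat (stream_dim N k) (stream_dim N k)"
    using fp_Gamma_carrier by auto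
  have "(1\<^sub>m (stream_dim N k) + (fp_Gamma N W k)\<^sup>H) * (fp_Phi N W k)\<^sup>H
      = (fp_Phi N W k * (1\<^sub>m (stream_dim N k) + fp_Gamma N W k))\<^sup>H"
    by (simp add: adjoint_mult[OF fp_Phi_carrier c] adjoint_add[OF one_carrier_mat fp_Gamma_carrier])
  then show ?thesis
    by (simp add: Phi_Gamma adjoint_real_smult)
qed

lemma Phi_Gamma_Phi_adjoint:
  "fp_Phi N W k * (1\<^sub>m (stream_dim N k) + fp_Gamma N W k) * (fp_Phi N W k)\<^sup>H
    = weight N k \<cdot>\<^sub>r mm_A N W k"
proof -
  \<comment> \<open>One square root comes from \<open>fp_Phi_eq\<close>, the other from
    \<open>Gamma_Phi_adjoint\<close>. For a positive weight their product is the weight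
    itself.\<close>
  have w: "complex_of_real (sqrt (weight N k)) * complex_of_real (sqrt (weight N k))
      = complex_of_real (weight N k)"
    using weight_pos by (simp flip: of_real_mult)
  have P: "minv (total_cov N W k) * (chan N k k * W k) \<in> carrier_mat (rx_dim N k) (stream_dim N k)"
    using total_cov_inverse(1) signal_carrier by auto
  \<comment> \<open>Gamma is replaced by its adjoint so that the right factor has the form of
    \<open>Gamma_Phi_adjoint\<close>; by self-adjointness this is only a reassociation.\<close>
  have "fp_Phi N W k * (1\<^sub>m (stream_dim N k) + fp_Gamma N W k) * (fp_Phi N W k)\<^sup>H
      = fp_Phi N W k * ((1\<^sub>m (stream_dim N k) + (fp_Gamma N W k)\<^sup>H) * (fp_Phi N W k)\<^sup>H)"
    unfolding fp_Gamma_adjoint using fp_Phi_carrier fp_Gamma_carrier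
    by (intro assoc_mult_mat) auto
  also have "\<dots> = fp_Phi N W k * (sqrt (weight N k) \<cdot>\<^sub>r mm_B N W k)"
    unfolding Gamma_Phi_adjoint ..
  also have "\<dots> = weight N k \<cdot>\<^sub>r mm_A N W k"
    unfolding fp_Phi_eq mm_A_eq mult_smult_distrib[OF smult_carrier_mat[OF P] mm_B_carrier]
      mult_smult_assoc_mat[OF P mm_B_carrier] smult_smult_times w ..
  finally show ?thesis .
qed

end

text \<open>The updates are compared as functions of the multiplier, because
  \<open>min_multiplier\<close> depends on the whole function. The matrices under
  \<open>pinv\<close> agree and so do the right factors, so equality passes through
  \<open>pinv\<close> by congruence.\<close>

lemma fp_update_eq_mm_update:
  assumes valid: "valid_network N" and bf: "beamformers N W" and k: "k \<in> {1..links N}"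
  shows "fp_update N W k = mm_update N W k"
proof
  fix \<mu>
  note d = dims[OF valid bf k]
  have term_eq: "(chan N j k)\<^sup>H * fp_Phi N W j * (1\<^sub>m (stream_dim N j) + fp_Gamma N W j)
        * (fp_Phi N W j)\<^sup>H * chan N j k
      = weight N j \<cdot>\<^sub>r ((chan N j k)\<^sup>H * mm_A N W j * chan N j k)"
    if j: "j \<in> {1..links N}" for j
  proof -
    let ?H = "chan N j k" and ?P = "fp_Phi N W j" and ?I = "1\<^sub>m (stream_dim N j) + fp_Gamma N W j"
    have H: "?H \<in> carrier_mat (rx_dim N j) (tx_dim N k)"
      and HH: "?H\<^sup>H \<in> carrier_mat (tx_dim N k) (rx_dim N j)"
      using d(1)[OF j k] by auto
    note P = fp_Phi_carrier[OF valid bf j] and A = mm_A_carrier[OF valid bf j]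
    have I: "?I \<in> carrier_mat (stream_dim N j) (stream_dim N j)"
      using fp_Gamma_carrier[OF valid bf j] by auto
    \<comment> \<open>Brackets the product so that the left-hand side of
      \<open>Phi_Gamma_Phi_adjoint\<close> for link j stands in the middle.\<close>
    have "?H\<^sup>H * ?P * ?I * ?P\<^sup>H = ?H\<^sup>H * (?P * ?I * ?P\<^sup>H)"
      using assoc_mult_mat[OF HH P I]
        assoc_mult_mat[OF HH mult_carrier_mat[OF P I] adjoint_carrier[OF P]] by simp
    also have "\<dots> = weight N j \<cdot>\<^sub>r (?H\<^sup>H * mm_A N W j)"
      unfolding Phi_Gamma_Phi_adjoint[OF valid bf j] by (rule mult_smult_distrib[OF HH A])
    finally show ?thesis
      by (simp add: mult_smult_assoc_mat[OF mult_carrier_mat[OF HH A] H])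
  qed
  have sum_eq: "mat_sum (tx_dim N k) (tx_dim N k)
        (\<lambda>j. (chan N j k)\<^sup>H * fp_Phi N W j * (1\<^sub>m (stream_dim N j) + fp_Gamma N W j)
              * (fp_Phi N W j)\<^sup>H * chan N j k) {1..links N}
      = mat_sum (tx_dim N k) (tx_dim N k)
        (\<lambda>j. weight N j \<cdot>\<^sub>r ((chan N j k)\<^sup>H * mm_A N W j * chan N j k)) {1..links N}"
  proof (rule mat_sum_cong)
    fix j assume j: "j \<in> {1..links N}"
    show "weight N j \<cdot>\<^sub>r ((chan N j k)\<^sup>H * mm_A N W j * chan N j k)
        \<in> carrier_mat (tx_dim N k) (tx_dim N k)"
      using d(1)[OF j k] mm_A_carrier[OF valid bf j] by auto
  qed (rule term_eq)
  have w: "complex_of_real (sqrt (weight N k)) * complex_of_real (sqrt (weight N k))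
      = complex_of_real (weight N k)"
    using weight_pos[OF valid bf k] by (simp flip: of_real_mult)
  have HH: "(chan N k k)\<^sup>H \<in> carrier_mat (tx_dim N k) (rx_dim N k)"
    using d(1)[OF k k] by auto
  have "(chan N k k)\<^sup>H * fp_Phi N W k * (1\<^sub>m (stream_dim N k) + fp_Gamma N W k)
      = (chan N k k)\<^sup>H * (sqrt (weight N k) \<cdot>\<^sub>r (mm_B N W k)\<^sup>H)"
    unfolding Phi_Gamma[OF valid bf k, symmetric]
    using HH fp_Phi_carrier[OF valid bf k] fp_Gamma_carrier[OF valid bf k]
    by (intro assoc_mult_mat) auto
  also have "\<dots> = sqrt (weight N k) \<cdot>\<^sub>r ((chan N k k)\<^sup>H * (mm_B N W k)\<^sup>H)"
    by (rule mult_smult_distrib[OF HH adjoint_carrier[OF mm_B_carrier[OF valid bf k]]])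
  \<comment> \<open>The square root in \<open>fp_update\<close> meets the one produced by
    \<open>Phi_Gamma\<close>, which gives the full weight of \<open>mm_update\<close>.\<close>
  finally have rhs_eq: "sqrt (weight N k) \<cdot>\<^sub>r
        ((chan N k k)\<^sup>H * fp_Phi N W k * (1\<^sub>m (stream_dim N k) + fp_Gamma N W k))
      = weight N k \<cdot>\<^sub>r ((chan N k k)\<^sup>H * (mm_B N W k)\<^sup>H)"
    by (simp add: smult_smult_times w)
  show "fp_update N W k \<mu> = mm_update N W k \<mu>"
    unfolding fp_update_def mm_update_def sum_eq rhs_eq ..
qed

theorem mainTheorem6:
  fixes N :: mimo_network and W :: "nat \<Rightarrow> complex mat"
  assumes "valid_network N"
    and "beamformers N W"
  shows "\<forall>k\<in>{1..links N}.
    (1 / weight N k) \<cdot>\<^sub>r (fp_Phi N W k * (1\<^sub>m (stream_dim N k) + fp_Gamma N W k) * (fp_Phi N W k)\<^sup>H)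
      = mm_A N W k \<and>
    (1 / sqrt (weight N k)) \<cdot>\<^sub>r ((1\<^sub>m (stream_dim N k) + (fp_Gamma N W k)\<^sup>H) * (fp_Phi N W k)\<^sup>H)
      = mm_B N W k \<and>
    fp_beamformer N W k = mm_beamformer N W k"
proof (intro ballI conjI)
  fix k assume k: "k \<in> {1..links N}"
  \<comment> \<open>Positivity lets both the weight and its square root cancel against the
    reciprocal scalars.\<close>
  note w = weight_pos[OF assms k]
  show "(1 / weight N k) \<cdot>\<^sub>r (fp_Phi N W k * (1\<^sub>m (stream_dim N k) + fp_Gamma N W k) * (fp_Phi N W k)\<^sup>H)
      = mm_A N W k"
    using w by (simp add: Phi_Gamma_Phi_adjoint[OF assms k] smult_smult_times one_smult)
  show "(1 / sqrt (weight N k)) \<cdot>\<^sub>r ((1\<^sub>m (stream_dim N k) + (fp_Gamma N W k)\<^sup>H) * (fp_Phi N W k)\<^sup>H)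
      = mm_B N W k"
    using w by (simp add: Gamma_Phi_adjoint[OF assms k] smult_smult_times one_smult)
  \<comment> \<open>Equal update functions give the same predicate under \<open>LEAST\<close>, hence
    the same multiplier in both algorithms.\<close>
  show "fp_beamformer N W k = mm_beamformer N W k"
    by (simp add: fp_beamformer_def mm_beamformer_def fp_update_eq_mm_update[OF assms k])
qed

end
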